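(* Let an input-output process with finite input alphabet $\mathcal X$, finite output alphabet $\mathcal Y$ and finitely many causal states be given. If its $\varepsilon$-transducer is step-wise inefficient, then $Q_X<C_X$ for every non-pathological stationary input process $\overleftrightarrow X$, where $C_X$ is the input-dependent statistical complexity of the $\varepsilon$-transducer and $Q_X$ is the input-dependent complexity of the quantum transducer.
   Context: Input-output process. $\mathcal X$ and $\mathcal Y$ are finite alphabets. An input-output process is a family of laws of bi-infinite output sequences $\overleftrightarrow Y=\cdots Y^{(-1)}Y^{(0)}Y^{(1)}\cdots$ over $\mathcal Y$, one for each bi-infinite input sequence $\overleftrightarrow x$ over $\mathcal X$, which is stationary (invariant under simultaneous time translation of inputs and outputs) and causal (outputs up to time $t$ do not depend on inputs after time $t$). A past is a pair $\overleftarrow z=(\overleftarrow x,\overleftarrow y)$ with $\overleftarrow x=\cdots x^{(-2)}x^{(-1)}$, $\overleftarrow y=\cdots y^{(-2)}y^{(-1)}$; futures are $\overrightarrow x=x^{(0)}x^{(1)}\cdots$, $\overrightarrow y=y^{(0)}y^{(1)}\cdots$. The process assigns to each past $\overleftarrow z$ and future input $\overrightarrow x$ a conditional law $P[\overrightarrow Y\mid\overrightarrow X=\overrightarrow x,\overleftarrow Z=\overleftarrow z]$ of the future output. Write $\mu_{x,y}(\overleftarrow z)=(\overleftarrow x x,\overleftarrow y y)$ for the past updated by one further input-output pair $(x,y)$. The conditional law is obtained by iterating the one-step probabilities: on input $x^{(0)}$ the output is $y^{(0)}$ with probability $P[Y^{(0)}=y^{(0)}\mid X^{(0)}=x^{(0)},\overleftarrow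 Z=\overleftarrow z]$, the past then becomes $\mu_{x^{(0)},y^{(0)}}(\overleftarrow z)$, and so on. Causal states and $\varepsilon$-transducer. Two pasts are equivalent, $\overleftarrow z\sim_\varepsilon\overleftarrow z'$, if $P[\overrightarrow Y\mid\overrightarrow X=\overrightarrow x,\overleftarrow Z=\overleftarrow z]=P[\overrightarrow Y\mid\overrightarrow X=\overrightarrow x,\overleftarrow Z=\overleftarrow z']$ for all future inputs $\overrightarrow x$. The equivalence classes $\mathcal S=\{s_0,\dots,s_{n-1}\}$ are the causal states, and $\varepsilon$ maps each past to its class. The transition elements are $T_{ij}^{y|x}=P[S^{(t)}=s_j,Y^{(t)}=y\mid S^{(t-1)}=s_i,X^{(t)}=x]$, where $S^{(t)}$ is the causal state of the past that includes time $t$; that is, for any $\overleftarrow z\in s_i$, $T_{ij}^{y|x}=P[Y^{(0)}=y\mid X^{(0)}=x,\overleftarrow Z=\overleftarrow z]$ if $\varepsilon(\mu_{x,y}(\overleftarrow z))=s_j$, and $T_{ij}^{y|x}=0$ otherwise. The $\varepsilon$-transducer is the model with state set $\mathcal S$ and these transition elements. Complexity. A stationary input process $\overleftrightarrow X$ (a stationary random bi-infinite sequence over $\mathcal X$) driving the process induces a distribution on pasts; put $p_X(i)=P[\varepsilon(\overleftarrow Z)=s_i]$ and $C_X=-\sum_i p_X(i)\log p_X(i)$. The input process is non-pathological if $p_X(i)>0$ for all $i$. Step-wise inefficiency. The $\varepsilon$-transducer is step-wise inefficient if there exist two distinct causal states $s_i\neq s_j$ such that for all $x\in\mathcal X$ there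 exist $y\in\mathcal Y$ and $s_k\in\mathcal S$ with both $T_{ik}^{y|x}$ and $T_{jk}^{y|x}$ non-zero. Quantum transducer. Let $\{|y\rangle\}_{y\in\mathcal Y}$ and $\{|k\rangle\}_{k=0}^{n-1}$ be orthonormal bases of spaces of dimension $|\mathcal Y|$ and $n$. The quantum causal states are $|s_i\rangle=\bigotimes_{x\in\mathcal X}|s_i^x\rangle$ with $|s_i^x\rangle=\sum_{k}\sum_{y}\sqrt{T_{ik}^{y|x}}\,|y\rangle|k\rangle$. Put $\rho_X=\sum_i p_X(i)|s_i\rangle\langle s_i|$ and $Q_X=-\mathrm{Tr}[\rho_X\log\rho_X]$. *)

theory Defs
  imports "HOL-Probability.Probability"
begin

section \<open>Input-output processes\<close>

abbreviation seq_space :: "('i \<Rightarrow> 'a) measure" where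
  "seq_space \<equiv> Pi\<^sub>M UNIV (\<lambda>_. count_space UNIV)"

text \<open>A past is a pair of one-sided sequences; index \<open>k\<close> stands for time \<open>- k - 1\<close>.\<close>

type_synonym ('x, 'y) past = "(nat \<Rightarrow> 'x) \<times> (nat \<Rightarrow> 'y)"

abbreviation past_space :: "('x, 'y) past measure" where
  "past_space \<equiv> seq_space \<Otimes>\<^sub>M seq_space"

definition past_of :: "(int \<Rightarrow> 'a) \<Rightarrow> nat \<Rightarrow> 'a" where
  "past_of w k = w (- int k - 1)"

definition shift :: "int \<Rightarrow> (int \<Rightarrow> 'a) \<Rightarrow> int \<Rightarrow> 'a" where
  "shift s w t = w (t + s)"

definition update_past :: "'x \<Rightarrow> 'y \<Rightarrow> ('x, 'y) past \<Rightarrow> ('x, 'y) past" where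
  "update_past x y z = (case_nat x (fst z), case_nat y (snd z))"

text \<open>\<open>L x\<close> is the law of the bi-infinite output for the bi-infinite input \<open>x\<close>, and
  \<open>pmf (K z x) y\<close> is the one-step probability of output \<open>y\<close> given past \<open>z\<close> and present input \<open>x\<close>.
  Since these probabilities are assigned to every single past, the process comes with the version
  \<open>K\<close> of the conditional probabilities of \<open>L\<close>; assumption \<open>conditional\<close> says that it is one.
  Conditioning at time 0 suffices because of stationarity.\<close>

locale io_process =
  fixes L :: "(int \<Rightarrow> 'x::finite) \<Rightarrow> (int \<Rightarrow> 'y::finite) measure"
    and K :: "('x, 'y) past \<Rightarrow> 'x \<Rightarrow> 'y pmf"
  assumes law_kernel: "L \<in> seq_space \<rightarrow>\<^sub>M prob_algebra seq_space"
    and stationary: "\<And>s x. L (shift s x) = distr (L x) seq_space (shift s)"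
    and causal: "\<And>t x x'. (\<forall>r\<le>t. x r = x' r) \<Longrightarrow>
      distr (L x) (Pi\<^sub>M {..t} (\<lambda>_. count_space UNIV)) (\<lambda>w. restrict w {..t}) =
      distr (L x') (Pi\<^sub>M {..t} (\<lambda>_. count_space UNIV)) (\<lambda>w. restrict w {..t})"
    and step_measurable: "\<And>x y. (\<lambda>z. pmf (K z x) y) \<in> borel_measurable past_space"
    and conditional: "\<And>x y A. A \<in> sets seq_space \<Longrightarrow>
      measure (L x) {w. past_of w \<in> A \<and> w 0 = y} =
      (\<integral>w. indicator A (past_of w) * pmf (K (past_of x, past_of w) (x 0)) y \<partial>L x)"

section \<open>Causal states and the transducer\<close>

primrec past_after ::
    "('x, 'y) past \<Rightarrow> (nat \<Rightarrow> 'x) \<Rightarrow> (nat \<Rightarrow> 'y) \<Rightarrow> nat \<Rightarrow> ('x, 'y) past" where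
  "past_after z x y 0 = z"
| "past_after z x y (Suc n) = update_past (x n) (y n) (past_after z x y n)"

text \<open>The conditional law of the future output: the Ionescu-Tulcea measure of the iterated
  one-step probabilities, that is, the projective limit of its finite-dimensional laws
  \<open>Ionescu_Tulcea.CI\<close>.\<close>

definition future_law ::
    "(('x, 'y) past \<Rightarrow> 'x \<Rightarrow> 'y pmf) \<Rightarrow> ('x, 'y) past \<Rightarrow> (nat \<Rightarrow> 'x) \<Rightarrow> (nat \<Rightarrow> 'y) measure" where
  "future_law K z x =
     projective_family.lim UNIV
       (Ionescu_Tulcea.CI
         (\<lambda>n y. measure_pmf (K (past_after z x y n) (x n))) (\<lambda>_. count_space UNIV))
       (\<lambda>_. count_space UNIV)"

definition causal_equiv ::
    "(('x, 'y) past \<Rightarrow> 'x \<Rightarrow> 'y pmf) \<Rightarrow> (('x, 'y) past \<times> ('x, 'y) past) set" where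
  "causal_equiv K = {(z, z'). \<forall>x. future_law K z x = future_law K z' x}"

definition causal_state ::
    "(('x, 'y) past \<Rightarrow> 'x \<Rightarrow> 'y pmf) \<Rightarrow> ('x, 'y) past \<Rightarrow> ('x, 'y) past set" where
  "causal_state K z = causal_equiv K `` {z}"

text \<open>From here on \<open>s\<close> enumerates the causal states without repetition by a finite index
  type \<open>'k\<close>; its cardinality is the number \<open>n\<close> of causal states.\<close>

definition enumerates_causal_states ::
    "(('x, 'y) past \<Rightarrow> 'x \<Rightarrow> 'y pmf) \<Rightarrow> ('k::finite \<Rightarrow> ('x, 'y) past set) \<Rightarrow> bool" where
  "enumerates_causal_states K s \<longleftrightarrow> bij_betw s UNIV (UNIV // causal_equiv K)"

text \<open>The choice of the representative \<open>z\<close> is immaterial: equivalent pasts have the same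
  one-step probabilities, and updating them by a pair of positive probability leaves them
  equivalent.\<close>

definition trans_elem ::
    "(('x, 'y) past \<Rightarrow> 'x \<Rightarrow> 'y pmf) \<Rightarrow> ('k \<Rightarrow> ('x, 'y) past set) \<Rightarrow>
     'k \<Rightarrow> 'k \<Rightarrow> 'y \<Rightarrow> 'x \<Rightarrow> real" where
  "trans_elem K s i j y x =
     (let z = (SOME z. z \<in> s i)
      in if causal_state K (update_past x y z) = s j then pmf (K z x) y else 0)"

definition step_wise_inefficient ::
    "(('x, 'y) past \<Rightarrow> 'x \<Rightarrow> 'y pmf) \<Rightarrow> ('k \<Rightarrow> ('x, 'y) past set) \<Rightarrow> bool" where
  "step_wise_inefficient K s \<longleftrightarrow>
     (\<exists>i j. s i \<noteq> s j \<and>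
       (\<forall>x. \<exists>y k. trans_elem K s i k y x \<noteq> 0 \<and> trans_elem K s j k y x \<noteq> 0))"

section \<open>Input processes and statistical complexity\<close>

definition stationary_input :: "(int \<Rightarrow> 'x) measure \<Rightarrow> bool" where
  "stationary_input \<mu> \<longleftrightarrow>
     \<mu> \<in> space (prob_algebra seq_space) \<and> (\<forall>s. distr \<mu> seq_space (shift s) = \<mu>)"

definition joint_law ::
    "((int \<Rightarrow> 'x) \<Rightarrow> (int \<Rightarrow> 'y) measure) \<Rightarrow> (int \<Rightarrow> 'x) measure \<Rightarrow>
     ((int \<Rightarrow> 'x) \<times> (int \<Rightarrow> 'y)) measure" where
  "joint_law L \<mu> = \<mu> \<bind> (\<lambda>x. distr (L x) (seq_space \<Otimes>\<^sub>M seq_space) (\<lambda>y. (x, y)))"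

definition past_law ::
    "((int \<Rightarrow> 'x) \<Rightarrow> (int \<Rightarrow> 'y) measure) \<Rightarrow> (int \<Rightarrow> 'x) measure \<Rightarrow> ('x, 'y) past measure" where
  "past_law L \<mu> = distr (joint_law L \<mu>) past_space (map_prod past_of past_of)"

definition state_prob ::
    "((int \<Rightarrow> 'x) \<Rightarrow> (int \<Rightarrow> 'y) measure) \<Rightarrow> (('x, 'y) past \<Rightarrow> 'x \<Rightarrow> 'y pmf) \<Rightarrow>
     ('k \<Rightarrow> ('x, 'y) past set) \<Rightarrow> (int \<Rightarrow> 'x) measure \<Rightarrow> 'k \<Rightarrow> real" where
  "state_prob L K s \<mu> i = measure (past_law L \<mu>) {z. causal_state K z = s i}"

definition non_pathological ::
    "((int \<Rightarrow> 'x) \<Rightarrow> (int \<Rightarrow> 'y) measure) \<Rightarrow> (('x, 'y) past \<Rightarrow> 'x \<Rightarrow> 'y pmf) \<Rightarrow>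
     ('k \<Rightarrow> ('x, 'y) past set) \<Rightarrow> (int \<Rightarrow> 'x) measure \<Rightarrow> bool" where
  "non_pathological L K s \<mu> \<longleftrightarrow> (\<forall>i. state_prob L K s \<mu> i > 0)"

definition statistical_complexity ::
    "((int \<Rightarrow> 'x) \<Rightarrow> (int \<Rightarrow> 'y) measure) \<Rightarrow> (('x, 'y) past \<Rightarrow> 'x \<Rightarrow> 'y pmf) \<Rightarrow>
     ('k::finite \<Rightarrow> ('x, 'y) past set) \<Rightarrow> (int \<Rightarrow> 'x) measure \<Rightarrow> real" where
  "statistical_complexity L K s \<mu> =
     - (\<Sum>i\<in>UNIV. state_prob L K s \<mu> i * log 2 (state_prob L K s \<mu> i))"

section \<open>Von Neumann entropy\<close>

definition adjoint_mat :: "complex ^ 'n ^ 'm \<Rightarrow> complex ^ 'm ^ 'n" where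
  "adjoint_mat A = (\<chi> i j. cnj (A $ j $ i))"

definition unitary_mat :: "complex ^ 'n ^ 'n \<Rightarrow> bool" where
  "unitary_mat U \<longleftrightarrow> adjoint_mat U ** U = mat 1 \<and> U ** adjoint_mat U = mat 1"

definition real_diag :: "('n \<Rightarrow> real) \<Rightarrow> complex ^ 'n ^ 'n" where
  "real_diag d = (\<chi> i j. if i = j then complex_of_real (d i) else 0)"

text \<open>Functional calculus of a Hermitian matrix; the result does not depend on the
  diagonalisation. Since \<open>log 2 0 = 0\<close> in HOL, the eigenvalue 0 contributes nothing to the
  entropy below.\<close>

definition hermitian_fun :: "(real \<Rightarrow> real) \<Rightarrow> complex ^ 'n ^ 'n \<Rightarrow> complex ^ 'n ^ 'n" where
  "hermitian_fun f A = (THE B. \<exists>U d. unitary_mat U \<and>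
     A = U ** real_diag d ** adjoint_mat U \<and>
     B = U ** real_diag (\<lambda>i. f (d i)) ** adjoint_mat U)"

definition von_neumann_entropy :: "complex ^ 'n ^ 'n \<Rightarrow> real" where
  "von_neumann_entropy \<rho> = - Re (trace (\<rho> ** hermitian_fun (log 2) \<rho>))"

section \<open>The quantum transducer\<close>

text \<open>The basis vector \<open>|y>|k>\<close> is \<open>axis (y, k) 1\<close>. The tensor product over all inputs of copies
  of the space with basis \<open>'b\<close> has the basis \<open>'x \<Rightarrow> 'b\<close>.\<close>

definition tensor_vec :: "('x::finite \<Rightarrow> complex ^ 'b) \<Rightarrow> complex ^ ('x \<Rightarrow> 'b)" where
  "tensor_vec v = (\<chi> f. \<Prod>x\<in>UNIV. v x $ f x)"

definition outer_self :: "complex ^ 'n \<Rightarrow> complex ^ 'n ^ 'n" where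
  "outer_self v = (\<chi> a b. v $ a * cnj (v $ b))"

definition quantum_state_at ::
    "(('x, 'y::finite) past \<Rightarrow> 'x \<Rightarrow> 'y pmf) \<Rightarrow> ('k::finite \<Rightarrow> ('x, 'y) past set) \<Rightarrow>
     'k \<Rightarrow> 'x \<Rightarrow> complex ^ ('y \<times> 'k)" where
  "quantum_state_at K s i x =
     (\<Sum>k\<in>UNIV. \<Sum>y\<in>UNIV. sqrt (trans_elem K s i k y x) *\<^sub>R axis (y, k) 1)"

definition quantum_state ::
    "(('x::finite, 'y::finite) past \<Rightarrow> 'x \<Rightarrow> 'y pmf) \<Rightarrow> ('k::finite \<Rightarrow> ('x, 'y) past set) \<Rightarrow>
     'k \<Rightarrow> complex ^ ('x \<Rightarrow> 'y \<times> 'k)" where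
  "quantum_state K s i = tensor_vec (quantum_state_at K s i)"

definition density_matrix ::
    "((int \<Rightarrow> 'x::finite) \<Rightarrow> (int \<Rightarrow> 'y::finite) measure) \<Rightarrow> (('x, 'y) past \<Rightarrow> 'x \<Rightarrow> 'y pmf) \<Rightarrow>
     ('k::finite \<Rightarrow> ('x, 'y) past set) \<Rightarrow> (int \<Rightarrow> 'x) measure \<Rightarrow>
     complex ^ ('x \<Rightarrow> 'y \<times> 'k) ^ ('x \<Rightarrow> 'y \<times> 'k)" where
  "density_matrix L K s \<mu> =
     (\<Sum>i\<in>UNIV. state_prob L K s \<mu> i *\<^sub>R outer_self (quantum_state K s i))"

definition quantum_complexity ::
    "((int \<Rightarrow> 'x::finite) \<Rightarrow> (int \<Rightarrow> 'y::finite) measure) \<Rightarrow> (('x, 'y) past \<Rightarrow> 'x \<Rightarrow> 'y pmf) \<Rightarrow>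
     ('k::finite \<Rightarrow> ('x, 'y) past set) \<Rightarrow> (int \<Rightarrow> 'x) measure \<Rightarrow> real" where
  "quantum_complexity L K s \<mu> = von_neumann_entropy (density_matrix L K s \<mu>)"

end

theory Submission
  imports Defs
begin

text \<open>Diagonalise the density matrix as \<open>\<rho> = U diag(d) U\<^sup>*\<close> and put
  \<open>w\<^sub>j\<^sub>i = \<surd>p\<^sub>i (U\<^sup>* s\<^sub>i)\<^sub>j\<close>. The rows of \<open>w\<close> are orthogonal with squared norms \<open>d\<^sub>j\<close>, so
  \<open>P\<^sub>i\<^sub>k = \<Sum>\<^sub>j cnj w\<^sub>j\<^sub>i w\<^sub>j\<^sub>k / d\<^sub>j\<close> is an orthogonal projection, and therefore \<open>P\<^sub>i\<^sub>i \<le> 1\<close>. Summing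
  \<open>ln (d\<^sub>j / p\<^sub>i) \<ge> 1 - p\<^sub>i / d\<^sub>j\<close> with weights \<open>|w\<^sub>j\<^sub>i|\<^sup>2\<close> gives
  \<open>H(p) - H(d) \<ge> \<Sum>\<^sub>i p\<^sub>i (1 - P\<^sub>i\<^sub>i) \<ge> 0\<close>. Equality forces \<open>d\<^sub>j = p\<^sub>i\<close> whenever \<open>w\<^sub>j\<^sub>i \<noteq> 0\<close>, hence
  \<open>P\<^sub>i\<^sub>i = 1\<close>, so that \<open>P\<close> is the identity and the \<open>s\<^sub>i\<close> are pairwise orthogonal. Step-wise
  inefficiency says precisely that two of the quantum causal states overlap, their overlap being a
  product over the inputs of sums of nonnegative terms.\<close>

section \<open>Entropy of a positive diagonal and of the spectrum\<close>

text \<open>Matrix-free core. \<open>w j i\<close> stands for the coordinate of the i-th weighted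
  vector along the j-th eigenvector: \<open>rows\<close> says that the mixture is diagonal in that
  basis, \<open>columns\<close> that vector i has squared norm \<open>p i\<close>.\<close>

lemma entropy_spectrum_less_entropy_diagonal:
  fixes w :: "'n::finite \<Rightarrow> 'k::finite \<Rightarrow> complex" and d :: "'n \<Rightarrow> real" and p :: "'k \<Rightarrow> real"
  assumes rows: "\<And>j l. (\<Sum>i\<in>UNIV. w j i * cnj (w l i)) = (if j = l then complex_of_real (d j) else 0)"
    and columns: "\<And>i. (\<Sum>j\<in>UNIV. (cmod (w j i))\<^sup>2) = p i"
    and pos: "\<And>i. p i > 0"
    and "a \<noteq> b" and overlap: "(\<Sum>j\<in>UNIV. cnj (w j a) * w j b) \<noteq> 0"
  shows "- (\<Sum>j\<in>UNIV. d j * log 2 (d j)) < - (\<Sum>i\<in>UNIV. p i * log 2 (p i))"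
proof -
  have row_norm: "(\<Sum>i\<in>UNIV. (cmod (w j i))\<^sup>2) = d j" for j
  proof -
    have "complex_of_real (\<Sum>i\<in>UNIV. (cmod (w j i))\<^sup>2) = complex_of_real (d j)"
      using rows[of j j] by (simp add: complex_norm_square flip: of_real_power)
    then show ?thesis using of_real_eq_iff by blast
  qed
  have d_nonneg: "d j \<ge> 0" for j
    unfolding row_norm[symmetric] by (intro sum_nonneg) simp
  \<comment> \<open>Zero eigenvalues are harmless: their rows vanish, and division by zero yields
    0.\<close>
  have w_zero: "w j i = 0" if "d j = 0" for j i
    using row_norm[of j] that by (simp add: sum_nonneg_eq_0_iff)
  \<comment> \<open>Sum of the rank-one projections onto the conjugated nonzero rows of
    \<open>w\<close>; \<open>B\<close> is its diagonal.\<close>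
  define P where "P i k = (\<Sum>j\<in>UNIV. cnj (w j i) * w j k / complex_of_real (d j))" for i k
  define B where "B i = (\<Sum>j\<in>UNIV. (cmod (w j i))\<^sup>2 / d j)" for i
  have P_diag: "P i i = complex_of_real (B i)" for i
    by (simp add: P_def B_def complex_norm_square mult.commute del: of_real_power)
  have P_cnj: "P k i = cnj (P i k)" for i k
    by (simp add: P_def mult.commute)
  have P_idem: "(\<Sum>k\<in>UNIV. P i k * P k l) = P i l" for i l
  proof -
    have "(\<Sum>k\<in>UNIV. P i k * P k l) = (\<Sum>k\<in>UNIV. \<Sum>j\<in>UNIV. \<Sum>m\<in>UNIV.
        (cnj (w j i) * w m l / (complex_of_real (d j) * complex_of_real (d m))) * (w j k * cnj (w m k)))"
      by (simp add: P_def sum_product mult_ac)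
    also have "\<dots> = (\<Sum>j\<in>UNIV. \<Sum>m\<in>UNIV. \<Sum>k\<in>UNIV.
        (cnj (w j i) * w m l / (complex_of_real (d j) * complex_of_real (d m))) * (w j k * cnj (w m k)))"
      by (subst sum.swap, intro sum.cong refl sum.swap)
    also have "\<dots> = (\<Sum>j\<in>UNIV. \<Sum>m\<in>UNIV.
        (if j = m then cnj (w j i) * w j l / complex_of_real (d j) else 0))"
      unfolding sum_distrib_left[symmetric] rows by (intro sum.cong refl) simp
    also have "\<dots> = P i l"
      by (simp add: P_def)
    finally show ?thesis .
  qed
  have P_row: "(\<Sum>k\<in>UNIV. (cmod (P i k))\<^sup>2) = B i" for i
  proof -
    have "complex_of_real (\<Sum>k\<in>UNIV. (cmod (P i k))\<^sup>2) = (\<Sum>k\<in>UNIV. P i k * P k i)"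
      by (simp add: P_cnj[of _ i] complex_norm_square flip: of_real_power)
    then have "complex_of_real (\<Sum>k\<in>UNIV. (cmod (P i k))\<^sup>2) = complex_of_real (B i)"
      by (simp only: P_idem P_diag)
    then show ?thesis using of_real_eq_iff by blast
  qed
  \<comment> \<open>Compares a diagonal entry of \<open>P\<close> with the squared norm of its row.
    This bounds \<open>B i\<close> by 1 and, when \<open>B i = 1\<close>, kills the rest of row
    i.\<close>
  have B_split: "B i = (B i)\<^sup>2 + (\<Sum>k\<in>UNIV - {i}. (cmod (P i k))\<^sup>2)" for i
    using P_row[of i] by (simp add: sum.remove[of UNIV i] P_diag)
  have B_le: "B i \<le> 1" for i
  proof (rule ccontr)
    assume "\<not> B i \<le> 1"
    then have "B i * 1 < B i * B i" by (intro mult_strict_left_mono) auto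
    moreover have "(\<Sum>k\<in>UNIV - {i}. (cmod (P i k))\<^sup>2) \<ge> 0" by (intro sum_nonneg) simp
    ultimately show False using B_split[of i] by (simp add: power2_eq_square)
  qed
  \<comment> \<open>Weighted slack in \<open>ln t \<le> t - 1\<close> at
    \<open>t = p i / d j\<close>. The logarithms are kept apart so that their double sums collapse,
    over i by \<open>row_norm\<close> and over j by \<open>columns\<close>.\<close>
  define g where "g j i = (cmod (w j i))\<^sup>2 * (ln (d j) - ln (p i)) -
    ((cmod (w j i))\<^sup>2 - p i * ((cmod (w j i))\<^sup>2 / d j))" for j i
  have g_alt: "g j i = (cmod (w j i))\<^sup>2 * (p i / d j - 1 - ln (p i / d j))" if "d j > 0" for i j
    using that pos[of i] by (simp add: g_def ln_div field_simps)
  have g_nonneg: "g j i \<ge> 0" for j i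
  proof (cases "d j = 0")
    case True
    then show ?thesis by (simp add: g_def w_zero)
  next
    case False
    then have "d j > 0" using d_nonneg[of j] by simp
    then show ?thesis
      using g_alt ln_le_minus_one[of "p i / d j"] pos[of i] by simp
  qed
  have g_zero: "d j = p i" if "g j i = 0" "w j i \<noteq> 0" for j i
  proof -
    have "d j > 0" using d_nonneg[of j] w_zero that by (metis order_le_less)
    moreover from this have "ln (p i / d j) = p i / d j - 1" using that g_alt[of j i] by simp
    ultimately show ?thesis using pos[of i] ln_eq_minus_one[of "p i / d j"] by simp
  qed
  have sum_g: "(\<Sum>j\<in>UNIV. \<Sum>i\<in>UNIV. g j i) =
      (\<Sum>j\<in>UNIV. d j * ln (d j)) - (\<Sum>i\<in>UNIV. p i * ln (p i)) - (\<Sum>i\<in>UNIV. p i * (1 - B i))"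
  proof -
    have "(\<Sum>j\<in>UNIV. \<Sum>i\<in>UNIV. (cmod (w j i))\<^sup>2 * ln (d j)) = (\<Sum>j\<in>UNIV. d j * ln (d j))"
      by (simp add: row_norm flip: sum_distrib_right)
    moreover have "(\<Sum>j\<in>UNIV. \<Sum>i\<in>UNIV. (cmod (w j i))\<^sup>2 * ln (p i)) = (\<Sum>i\<in>UNIV. p i * ln (p i))"
      by (subst sum.swap) (simp add: columns flip: sum_distrib_right)
    moreover have "(\<Sum>j\<in>UNIV. \<Sum>i\<in>UNIV. (cmod (w j i))\<^sup>2 - p i * ((cmod (w j i))\<^sup>2 / d j)) =
        (\<Sum>i\<in>UNIV. p i * (1 - B i))"
      by (subst sum.swap)
        (simp add: sum_subtractf columns B_def right_diff_distrib sum_distrib_left)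
    ultimately show ?thesis
      by (simp add: g_def sum_subtractf right_diff_distrib)
  qed
  have defect: "(\<Sum>i\<in>UNIV. p i * (1 - B i)) \<ge> 0"
    using B_le pos by (intro sum_nonneg mult_nonneg_nonneg) (auto simp: less_imp_le)
  \<comment> \<open>Strictness comes from \<open>g\<close>: were every slack zero,
    \<open>P a b\<close> would be both 0 and the overlap divided by \<open>p a\<close>.\<close>
  have "(\<Sum>j\<in>UNIV. \<Sum>i\<in>UNIV. g j i) > 0"
  proof (rule ccontr)
    assume "\<not> (\<Sum>j\<in>UNIV. \<Sum>i\<in>UNIV. g j i) > 0"
    then have "(\<Sum>j\<in>UNIV. \<Sum>i\<in>UNIV. g j i) = 0"
      using g_nonneg by (meson linorder_neqE_linordered_idom not_less sum_nonneg)
    then have "g j i = 0" for j i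
      using g_nonneg by (simp add: sum_nonneg_eq_0_iff sum_nonneg)
    then have eigen: "d j = p i" if "w j i \<noteq> 0" for j i
      using g_zero that by blast
    \<comment> \<open>Exchanging \<open>d j\<close> for \<open>p a\<close> is safe termwise: where
      they differ, \<open>w j a = 0\<close>.\<close>
    have "B a = (\<Sum>j\<in>UNIV. (cmod (w j a))\<^sup>2 / p a)"
      unfolding B_def by (intro sum.cong refl) (metis eigen div_0 norm_zero zero_power2)
    also have "\<dots> = 1"
      using pos[of a] by (simp add: columns flip: sum_divide_distrib)
    finally have "(\<Sum>k\<in>UNIV - {a}. (cmod (P a k))\<^sup>2) = 0"
      using B_split[of a] by simp
    then have "P a b = 0"
      using \<open>a \<noteq> b\<close> by (simp add: sum_nonneg_eq_0_iff)
    moreover have "P a b = (\<Sum>j\<in>UNIV. cnj (w j a) * w j b / complex_of_real (p a))"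
      unfolding P_def by (intro sum.cong refl) (metis eigen complex_cnj_zero div_0 mult_zero_left)
    ultimately show False
      using overlap pos[of a] by (simp flip: sum_divide_distrib)
  qed
  with sum_g defect have "(\<Sum>i\<in>UNIV. p i * ln (p i)) < (\<Sum>j\<in>UNIV. d j * ln (d j))"
    by simp
  then show ?thesis
    by (simp add: log_def divide_strict_right_mono flip: sum_divide_distrib)
qed

section \<open>The spectral theorem and the functional calculus\<close>

text \<open>Maximise the Rayleigh quotient over the unit sphere of \<open>W\<close>; at a maximiser
  the first variation vanishes. Only real scalars occur, so complex vectors are covered as a real
  Euclidean space.\<close>

lemma self_adjoint_eigenvector:
  fixes f :: "'a::euclidean_space \<Rightarrow> 'a"
  assumes "linear f" and self_adjoint: "\<And>x y. f x \<bullet> y = x \<bullet> f y"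
    and W: "subspace W" and invariant: "\<And>x. x \<in> W \<Longrightarrow> f x \<in> W"
    and "v \<in> W" "v \<noteq> 0"
  obtains u c where "u \<in> W" "norm u = 1" "f u = c *\<^sub>R u"
proof -
  interpret linear f by fact
  let ?S = "W \<inter> sphere 0 1"
  have "compact ?S"
    using W by (intro closed_Int_compact closed_subspace) auto
  moreover have "v /\<^sub>R norm v \<in> ?S"
    using assms by (simp add: subspace_scale)
  moreover have "continuous_on ?S (\<lambda>x. x \<bullet> f x)"
    using linear_conv_bounded_linear \<open>linear f\<close> by (intro continuous_intros linear_continuous_on) blast
  ultimately obtain u where u: "u \<in> ?S" and max: "\<And>x. x \<in> ?S \<Longrightarrow> x \<bullet> f x \<le> u \<bullet> f u"
    using continuous_attains_sup[of ?S "\<lambda>x. x \<bullet> f x"] by blast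
  define c where "c = u \<bullet> f u"
  have uu: "u \<bullet> u = 1" using u by (simp add: norm_eq_1)
  have quadratic: "x \<bullet> f x \<le> c * (x \<bullet> x)" if "x \<in> W" for x
  proof (cases "x = 0")
    case False
    then have "x /\<^sub>R norm x \<in> ?S" using that W by (simp add: subspace_scale)
    from max[OF this] have "x \<bullet> f x / (norm x)\<^sup>2 \<le> c"
      by (simp add: c_def scale power2_eq_square divide_inverse mult_ac)
    then show ?thesis
      using False by (simp add: field_simps power2_norm_eq_inner[symmetric])
  qed simp
  \<comment> \<open>The residual of the eigenvalue equation. It lies in \<open>W\<close> by
    invariance, hence is an admissible direction, and the variation along it has linear coefficient
    \<open>2 * (h \<bullet> h)\<close>.\<close>
  define h where "h = c *\<^sub>R u - f u"
  have "h \<in> W" unfolding h_def using u W invariant by (intro subspace_diff subspace_scale) auto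
  define q where "q = c * (h \<bullet> h) - h \<bullet> f h"
  have variation: "2 * t * (h \<bullet> h) + t\<^sup>2 * q \<ge> 0" for t
  proof -
    have "u + t *\<^sub>R h \<in> W" using u \<open>h \<in> W\<close> W by (intro subspace_add subspace_scale) auto
    from quadratic[OF this]
    have "0 \<le> c * ((u + t *\<^sub>R h) \<bullet> (u + t *\<^sub>R h)) - (u + t *\<^sub>R h) \<bullet> f (u + t *\<^sub>R h)" by simp
    also have "\<dots> = 2 * t * (c * (h \<bullet> u) - h \<bullet> f u) + t\<^sup>2 * q"
      using self_adjoint[of u h]
      by (simp add: add scale inner_add_left inner_add_right q_def uu c_def inner_commute
          power2_eq_square algebra_simps)
    also have "c * (h \<bullet> u) - h \<bullet> f u = h \<bullet> h"
      by (simp add: h_def inner_diff_right inner_diff_left inner_commute algebra_simps)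
    finally show ?thesis .
  qed
  have "h \<bullet> h = 0"
  proof (rule ccontr)
    assume "h \<bullet> h \<noteq> 0"
    then have hh: "h \<bullet> h > 0" by simp
    \<comment> \<open>Small and negative: the denominator keeps the quadratic term from offsetting
      the linear one, and the added 1 covers \<open>q = 0\<close>.\<close>
    define t where "t = - (h \<bullet> h) / (\<bar>q\<bar> + 1)"
    have "t < 0" using hh by (simp add: t_def)
    have "t * (2 * (h \<bullet> h) + t * q) \<ge> 0"
      using variation[of t] by (simp add: power2_eq_square algebra_simps)
    then have "2 * (h \<bullet> h) + t * q \<le> 0"
      using \<open>t < 0\<close> by (simp add: zero_le_mult_iff)
    moreover have "\<bar>t * q\<bar> \<le> h \<bullet> h"
      by (simp add: t_def abs_mult divide_le_eq mult_left_mono)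
    ultimately show False using hh by linarith
  qed
  then have "f u = c *\<^sub>R u" by (simp add: h_def)
  then show thesis using that u by auto
qed

section \<open>Complex inner products and unitary diagonalisation\<close>

text \<open>Conjugate-linear in the first argument. On complex vectors \<open>\<bullet>\<close> is
  only the real part of this, too weak for unitary orthogonality.\<close>

definition complex_inner :: "complex ^ 'n \<Rightarrow> complex ^ 'n \<Rightarrow> complex" where
  "complex_inner x y = (\<Sum>i\<in>UNIV. cnj (x $ i) * y $ i)"

lemma Re_complex_inner: "Re (complex_inner x y) = x \<bullet> y"
  by (simp add: complex_inner_def inner_vec_def inner_complex_def)

lemma complex_inner_self: "complex_inner x x = complex_of_real ((norm x)\<^sup>2)"
  by (simp add: complex_inner_def norm_vec_def L2_set_def sum_nonneg complex_norm_square mult.commute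
      del: of_real_power)

lemma complex_inner_commute: "complex_inner y x = cnj (complex_inner x y)"
  by (simp add: complex_inner_def mult.commute)

lemma complex_inner_adjoint: "complex_inner (adjoint_mat A *v x) y = complex_inner x (A *v y)"
proof -
  have "complex_inner (adjoint_mat A *v x) y = (\<Sum>i\<in>UNIV. \<Sum>j\<in>UNIV. A $ j $ i * cnj (x $ j) * y $ i)"
    by (simp add: complex_inner_def adjoint_mat_def matrix_vector_mult_def sum_distrib_right)
  also have "\<dots> = (\<Sum>j\<in>UNIV. \<Sum>i\<in>UNIV. A $ j $ i * cnj (x $ j) * y $ i)"
    by (rule sum.swap)
  also have "\<dots> = complex_inner x (A *v y)"
    by (simp add: complex_inner_def matrix_vector_mult_def sum_distrib_left mult_ac)
  finally show ?thesis .
qed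

lemma matrix_vector_mult_linear_complex: "linear ((*v) (A :: complex ^ 'n ^ 'm))"
  by (intro linearI)
    (simp_all add: vec_eq_iff matrix_vector_mult_def algebra_simps sum.distrib scaleR_sum_right)

text \<open>Induction on \<open>S\<close>: the orthogonal complement of the eigenvectors found so
  far is invariant under \<open>A\<close>, so it contains a further one. Indexing by the matrix
  indices makes the family ready to serve as columns.\<close>

lemma hermitian_orthonormal_eigenvectors:
  fixes A :: "complex ^ 'n::finite ^ 'n" and S :: "'n set"
  assumes "adjoint_mat A = A"
  shows "\<exists>e l. (\<forall>i\<in>S. A *v e i = complex_of_real (l i) *s e i) \<and>
    (\<forall>i\<in>S. \<forall>j\<in>S. complex_inner (e i) (e j) = (if i = j then 1 else 0))"
  using finite[of S]
proof (induction S rule: finite_induct)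
  case (insert a S)
  then obtain e l where eigen: "\<And>i. i \<in> S \<Longrightarrow> A *v e i = complex_of_real (l i) *s e i"
    and orth: "\<And>i j. i \<in> S \<Longrightarrow> j \<in> S \<Longrightarrow> complex_inner (e i) (e j) = (if i = j then 1 else 0)"
    by blast
  have symmetric: "complex_inner (A *v x) y = complex_inner x (A *v y)" for x y
    using complex_inner_adjoint[of A] assms by simp
  define W where "W = {v. \<forall>i\<in>S. complex_inner (e i) v = 0}"
  have "subspace W"
    by (auto simp: W_def subspace_def complex_inner_def algebra_simps sum.distrib
        simp flip: scaleR_sum_right)
  moreover have "A *v v \<in> W" if "v \<in> W" for v
  proof -
    have "complex_inner (e i) (A *v v) = complex_of_real (l i) * complex_inner (e i) v" if "i \<in> S" for i
      unfolding symmetric[symmetric] eigen[OF that]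
      by (simp add: complex_inner_def sum_distrib_left mult_ac)
    then show ?thesis using that by (simp add: W_def)
  qed
  moreover have "\<exists>v\<in>W. v \<noteq> 0"
  proof -
    \<comment> \<open>Conjugated eigenvectors as rows, zero rows elsewhere. As \<open>a\<close> lies
      outside \<open>S\<close>, row a vanishes, and a kernel vector of \<open>M\<close> is
      orthogonal to all earlier eigenvectors.\<close>
    define M :: "complex ^ 'n ^ 'n" where "M = (\<chi> i j. if i \<in> S then cnj (e i $ j) else 0)"
    have "row a M = 0" using insert by (simp add: M_def row_def vec_eq_iff)
    then have "\<not> invertible M"
      by (simp add: invertible_det_nz det_zero_row(2)[of a])
    then obtain v where "M *v v = 0" "v \<noteq> 0"
      using matrix_left_invertible_ker[of M] invertible_left_inverse by metis
    moreover have "complex_inner (e i) v = (M *v v) $ i" if "i \<in> S" for i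
      using that by (simp add: M_def complex_inner_def matrix_vector_mult_def)
    ultimately show ?thesis by (auto simp: W_def)
  qed
  moreover have "(A *v x) \<bullet> y = x \<bullet> (A *v y)" for x y
    by (simp add: symmetric flip: Re_complex_inner)
  ultimately obtain u c where u: "u \<in> W" "norm u = 1" "A *v u = c *\<^sub>R u"
    using self_adjoint_eigenvector[OF matrix_vector_mult_linear_complex[of A]] by metis
  have "complex_inner u (e i) = 0" if "i \<in> S" for i
    using u(1) that complex_inner_commute[of u "e i"] by (simp add: W_def)
  moreover have "A *v u = complex_of_real c *s u"
    using u(3) by (simp add: vec_eq_iff scaleR_conv_of_real[where 'a = complex])
  moreover have "complex_inner u u = 1" using u(2) by (simp add: complex_inner_self)
  ultimately show ?case
    using insert(2) eigen orth u(1)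
    by (intro exI[of _ "e(a := u)"] exI[of _ "l(a := c)"]) (auto simp: W_def)
qed simp

lemma hermitian_diagonalisation:
  fixes A :: "complex ^ 'n::finite ^ 'n"
  assumes "adjoint_mat A = A"
  obtains U d where "unitary_mat U" "A = U ** real_diag d ** adjoint_mat U"
proof -
  obtain e :: "'n \<Rightarrow> complex ^ 'n" and l where eigen: "\<And>i. A *v e i = complex_of_real (l i) *s e i"
    and orth: "\<And>i j. complex_inner (e i) (e j) = (if i = j then 1 else 0)"
    using hermitian_orthonormal_eigenvectors[OF assms, of UNIV] by auto
  define U :: "complex ^ 'n ^ 'n" where "U = (\<chi> i j. e j $ i)"
  have "adjoint_mat U ** U = mat 1"
    using orth by (simp add: vec_eq_iff adjoint_mat_def U_def matrix_matrix_mult_def mat_def complex_inner_def)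
  moreover from this have "U ** adjoint_mat U = mat 1"
    using matrix_left_right_inverse by blast
  ultimately have U: "unitary_mat U" by (simp add: unitary_mat_def)
  have "A ** U = U ** real_diag l"
    using eigen by (simp add: vec_eq_iff U_def matrix_matrix_mult_def matrix_vector_mult_def
        real_diag_def if_distrib if_distribR mult.commute cong: if_cong)
  then have "A ** (U ** adjoint_mat U) = U ** real_diag l ** adjoint_mat U"
    by (simp add: matrix_mul_assoc)
  then have "A = U ** real_diag l ** adjoint_mat U"
    using U by (simp add: unitary_mat_def)
  then show thesis using that U by blast
qed

section \<open>Functional calculus and entropy in an eigenbasis\<close>

lemma real_diag_mult_left: "(real_diag d ** A) $ i $ j = complex_of_real (d i) * A $ i $ j"
  by (simp add: real_diag_def matrix_matrix_mult_def if_distrib if_distribR cong: if_cong)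

lemma real_diag_mult_right: "(A ** real_diag d) $ i $ j = A $ i $ j * complex_of_real (d j)"
  by (simp add: real_diag_def matrix_matrix_mult_def if_distrib if_distribR cong: if_cong)

text \<open>Two diagonalisations are intertwined by \<open>X = adjoint_mat V ** U\<close>, whose
  entry (i, j) vanishes unless \<open>d j = e i\<close>. Hence \<open>X\<close> also intertwines the
  diagonals after applying \<open>f\<close>, and the description in \<open>hermitian_fun\<close> has
  a unique solution.\<close>

lemma hermitian_fun_eq:
  assumes U: "unitary_mat U" and A: "A = U ** real_diag d ** adjoint_mat U"
  shows "hermitian_fun f A = U ** real_diag (\<lambda>i. f (d i)) ** adjoint_mat U"
  unfolding hermitian_fun_def
proof (rule the_equality)
  show "\<exists>V e. unitary_mat V \<and> A = V ** real_diag e ** adjoint_mat V \<and>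
      U ** real_diag (\<lambda>i. f (d i)) ** adjoint_mat U = V ** real_diag (\<lambda>i. f (e i)) ** adjoint_mat V"
    using assms by blast
next
  fix B
  assume "\<exists>V e. unitary_mat V \<and> A = V ** real_diag e ** adjoint_mat V \<and>
      B = V ** real_diag (\<lambda>i. f (e i)) ** adjoint_mat V"
  then obtain V e where V: "unitary_mat V" and AV: "A = V ** real_diag e ** adjoint_mat V"
    and B: "B = V ** real_diag (\<lambda>i. f (e i)) ** adjoint_mat V" by blast
  define X where "X = adjoint_mat V ** U"
  have UU: "adjoint_mat U ** U = mat 1" "U ** adjoint_mat U = mat 1"
    and VV: "adjoint_mat V ** V = mat 1" "V ** adjoint_mat V = mat 1"
    using U V by (auto simp: unitary_mat_def)
  have "X ** real_diag d = adjoint_mat V ** (U ** real_diag d ** adjoint_mat U) ** U"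
    unfolding X_def by (simp add: matrix_mul_assoc[symmetric] UU)
  also have "\<dots> = adjoint_mat V ** (V ** real_diag e ** adjoint_mat V) ** U"
    using A AV by simp
  also have "\<dots> = (adjoint_mat V ** V) ** real_diag e ** X"
    unfolding X_def by (simp add: matrix_mul_assoc)
  finally have "X ** real_diag d = real_diag e ** X"
    by (simp add: VV)
  then have "X $ i $ j * complex_of_real (d j) = complex_of_real (e i) * X $ i $ j" for i j
    by (metis real_diag_mult_left real_diag_mult_right)
  then have "X $ i $ j = 0 \<or> d j = e i" for i j
    by (metis mult.commute mult_cancel_left of_real_eq_iff)
  then have X: "X ** real_diag (\<lambda>i. f (d i)) = real_diag (\<lambda>i. f (e i)) ** X"
    unfolding vec_eq_iff real_diag_mult_left real_diag_mult_right by (metis mult.commute mult_zero_left)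
  have "B = V ** (real_diag (\<lambda>i. f (e i)) ** X) ** adjoint_mat U"
    unfolding B X_def by (simp add: matrix_mul_assoc[symmetric] UU)
  also have "\<dots> = (V ** adjoint_mat V) ** U ** real_diag (\<lambda>i. f (d i)) ** adjoint_mat U"
    unfolding X[symmetric] by (simp add: X_def matrix_mul_assoc)
  finally show "B = U ** real_diag (\<lambda>i. f (d i)) ** adjoint_mat U"
    by (simp add: VV)
qed

text \<open>The unitaries cancel, between the two factors directly and at the ends by cyclicity of
  the trace.\<close>

lemma von_neumann_entropy_eq:
  assumes U: "unitary_mat U" and A: "A = U ** real_diag d ** adjoint_mat U"
  shows "von_neumann_entropy A = - (\<Sum>j\<in>UNIV. d j * log 2 (d j))"
proof -
  have UU: "adjoint_mat U ** U = mat 1" using U by (simp add: unitary_mat_def)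
  let ?E = "real_diag (\<lambda>j. log 2 (d j))"
  have "A ** hermitian_fun (log 2) A =
      U ** real_diag d ** (adjoint_mat U ** U) ** ?E ** adjoint_mat U"
    unfolding hermitian_fun_eq[OF assms] by (simp add: A matrix_mul_assoc)
  also have "\<dots> = U ** (real_diag d ** ?E ** adjoint_mat U)"
    by (simp add: UU matrix_mul_assoc)
  finally have "trace (A ** hermitian_fun (log 2) A) = trace (real_diag d ** ?E ** adjoint_mat U ** U)"
    by (metis trace_mul_sym)
  also have "\<dots> = trace (real_diag d ** ?E)"
    by (metis UU matrix_mul_assoc matrix_mul_rid)
  also have "\<dots> = (\<Sum>j\<in>UNIV. complex_of_real (d j) * complex_of_real (log 2 (d j)))"
    unfolding trace_def real_diag_mult_left by (simp add: real_diag_def)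
  finally show ?thesis by (simp add: von_neumann_entropy_def)
qed

section \<open>Mixtures of overlapping unit vectors\<close>

text \<open>Passing to an eigenbasis of the mixture and scaling each vector by the root of its
  weight reduces this to the scalar inequality.\<close>

lemma von_neumann_entropy_mixture_less:
  fixes v :: "'k::finite \<Rightarrow> complex ^ 'n::finite"
  assumes unit: "\<And>i. complex_inner (v i) (v i) = 1" and pos: "\<And>i. p i > 0"
    and "a \<noteq> b" and overlap: "complex_inner (v a) (v b) \<noteq> 0"
  shows "von_neumann_entropy (\<Sum>i\<in>UNIV. p i *\<^sub>R outer_self (v i)) < - (\<Sum>i\<in>UNIV. p i * log 2 (p i))"
proof -
  let ?\<rho> = "\<Sum>i\<in>UNIV. p i *\<^sub>R outer_self (v i)"
  have "adjoint_mat ?\<rho> = ?\<rho>"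
    by (simp add: vec_eq_iff adjoint_mat_def outer_self_def mult.commute)
  then obtain U d where U: "unitary_mat U" and \<rho>: "?\<rho> = U ** real_diag d ** adjoint_mat U"
    by (rule hermitian_diagonalisation)
  have UU: "adjoint_mat U ** U = mat 1" "U ** adjoint_mat U = mat 1"
    using U by (auto simp: unitary_mat_def)
  define x where "x i = adjoint_mat U *v v i" for i
  define w where "w j i = complex_of_real (sqrt (p i)) * x i $ j" for j i
  \<comment> \<open>Unitarity preserves inner products. Diagonal entries give the column norms,
    entry (a, b) the overlap.\<close>
  have gram: "(\<Sum>j\<in>UNIV. cnj (w j i) * w j k) =
      complex_of_real (sqrt (p i) * sqrt (p k)) * complex_inner (v i) (v k)" for i k
  proof -
    have "(\<Sum>j\<in>UNIV. cnj (w j i) * w j k) =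
        complex_of_real (sqrt (p i) * sqrt (p k)) * complex_inner (x i) (x k)"
      by (simp add: w_def complex_inner_def sum_distrib_left mult_ac)
    also have "complex_inner (x i) (x k) = complex_inner (v i) (v k)"
      unfolding x_def complex_inner_adjoint by (simp add: matrix_vector_mul_assoc UU)
    finally show ?thesis .
  qed
  \<comment> \<open>Entry (j, l) of \<open>adjoint_mat U ** ?\<rho> ** U\<close>, which is
    diagonal.\<close>
  have rows: "(\<Sum>i\<in>UNIV. w j i * cnj (w l i)) = (if j = l then complex_of_real (d j) else 0)" for j l
  proof -
    have "(\<Sum>i\<in>UNIV. w j i * cnj (w l i)) = (\<Sum>i\<in>UNIV. complex_of_real (p i) * (x i $ j * cnj (x i $ l)))"
    proof (intro sum.cong refl)
      fix i
      have "complex_of_real (sqrt (p i)) * complex_of_real (sqrt (p i)) = complex_of_real (p i)"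
        using pos[of i] by (simp flip: of_real_mult)
      then show "w j i * cnj (w l i) = complex_of_real (p i) * (x i $ j * cnj (x i $ l))"
        unfolding w_def by (simp add: mult_ac)
    qed
    also have "\<dots> = (\<Sum>i\<in>UNIV. \<Sum>m\<in>UNIV. \<Sum>n\<in>UNIV.
        cnj (U $ m $ j) * (complex_of_real (p i) * (v i $ m * cnj (v i $ n))) * U $ n $ l)"
      by (simp add: x_def matrix_vector_mult_def adjoint_mat_def sum_product sum_distrib_left mult_ac)
        (intro sum.cong refl sum.swap)
    also have "\<dots> = (\<Sum>m\<in>UNIV. \<Sum>n\<in>UNIV. \<Sum>i\<in>UNIV.
        cnj (U $ m $ j) * (complex_of_real (p i) * (v i $ m * cnj (v i $ n))) * U $ n $ l)"
      by (subst sum.swap, intro sum.cong refl sum.swap)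
    also have "\<dots> = (\<Sum>m\<in>UNIV. \<Sum>n\<in>UNIV. cnj (U $ m $ j) * ?\<rho> $ m $ n * U $ n $ l)"
      by (simp add: outer_self_def sum_distrib_left sum_distrib_right
          scaleR_conv_of_real[where 'a = complex])
    also have "\<dots> = (\<Sum>n\<in>UNIV. \<Sum>m\<in>UNIV. cnj (U $ m $ j) * ?\<rho> $ m $ n * U $ n $ l)"
      by (rule sum.swap)
    also have "\<dots> = (adjoint_mat U ** ?\<rho> ** U) $ j $ l"
      by (simp add: matrix_matrix_mult_def adjoint_mat_def sum_distrib_right)
    also have "adjoint_mat U ** ?\<rho> ** U = (adjoint_mat U ** U) ** real_diag d ** (adjoint_mat U ** U)"
      unfolding \<rho> by (simp add: matrix_mul_assoc)
    also have "\<dots> = real_diag d" by (simp add: UU)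
    finally show ?thesis by (simp add: real_diag_def)
  qed
  have columns: "(\<Sum>j\<in>UNIV. (cmod (w j i))\<^sup>2) = p i" for i
  proof -
    have "complex_of_real (\<Sum>j\<in>UNIV. (cmod (w j i))\<^sup>2) = (\<Sum>j\<in>UNIV. cnj (w j i) * w j i)"
      by (simp add: complex_norm_square mult.commute flip: of_real_power)
    also have "\<dots> = complex_of_real (p i)"
      using pos[of i] by (simp add: gram unit flip: of_real_mult)
    finally show ?thesis using of_real_eq_iff by blast
  qed
  have "(\<Sum>j\<in>UNIV. cnj (w j a) * w j b) \<noteq> 0"
    using overlap pos[of a] pos[of b] by (simp add: gram)
  then show ?thesis
    unfolding von_neumann_entropy_eq[OF U \<rho>]
    using entropy_spectrum_less_entropy_diagonal[OF rows columns pos \<open>a \<noteq> b\<close>] by blast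
qed

section \<open>Overlaps of the quantum causal states\<close>

text \<open>Distributivity: a product over inputs of sums over basis vectors is a sum over choice
  functions, which index the basis of the tensor product.\<close>

lemma complex_inner_tensor_vec:
  fixes u v :: "'x::finite \<Rightarrow> complex ^ 'b::finite"
  shows "complex_inner (tensor_vec u) (tensor_vec v) = (\<Prod>x\<in>UNIV. complex_inner (u x) (v x))"
  unfolding complex_inner_def tensor_vec_def
  by (subst prod_sum_PiE) (simp_all add: prod.distrib PiE_UNIV_domain)

lemma trans_elem_nonneg: "trans_elem K s i j y x \<ge> 0"
  by (simp add: trans_elem_def Let_def)

text \<open>With past and input fixed, each output leads to exactly one causal state, so what
  remains is the total mass of a pmf.\<close>

lemma sum_trans_elem:
  fixes K :: "('x, 'y::finite) past \<Rightarrow> 'x \<Rightarrow> 'y pmf"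
  assumes "enumerates_causal_states K s"
  shows "(\<Sum>k\<in>UNIV. \<Sum>y\<in>UNIV. trans_elem K s i k y x) = 1"
proof -
  define z where "z = (SOME z. z \<in> s i)"
  \<comment> \<open>Existence is surjectivity of \<open>s\<close> onto the classes, uniqueness its
    injectivity.\<close>
  have "\<exists>!k. causal_state K (update_past x y z) = s k" for y
  proof -
    have "causal_state K (update_past x y z) \<in> UNIV // causal_equiv K"
      by (simp add: causal_state_def quotientI)
    then show ?thesis
      using assms unfolding enumerates_causal_states_def bij_betw_def by (metis UNIV_I imageE injD)
  qed
  then obtain \<kappa> where \<kappa>: "causal_state K (update_past x y z) = s k \<longleftrightarrow> k = \<kappa> y" for y k
    by metis
  have "(\<Sum>k\<in>UNIV. \<Sum>y\<in>UNIV. trans_elem K s i k y x) =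
      (\<Sum>y\<in>UNIV. \<Sum>k\<in>UNIV. if k = \<kappa> y then pmf (K z x) y else 0)"
    by (subst sum.swap) (simp add: trans_elem_def \<kappa> flip: z_def)
  also have "\<dots> = 1"
    using sum_pmf_eq_1[of UNIV "K z x"] by simp
  finally show ?thesis .
qed

lemma quantum_state_at_nth:
  "quantum_state_at K s i x $ (y, k) = complex_of_real (sqrt (trans_elem K s i k y x))"
proof -
  have "quantum_state_at K s i x $ (y, k) = (\<Sum>k'\<in>UNIV. \<Sum>y'\<in>UNIV.
      if k' = k then if y' = y then complex_of_real (sqrt (trans_elem K s i k y x)) else 0 else 0)"
    unfolding quantum_state_at_def
    by (auto simp: axis_def scaleR_conv_of_real[where 'a = complex] intro!: sum.cong)
  also have "\<dots> = complex_of_real (sqrt (trans_elem K s i k y x))"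
    by (subst sum.swap) simp
  finally show ?thesis .
qed

text \<open>Amplitudes are real, so the conjugation disappears and a sum of Bhattacharyya type is
  left.\<close>

lemma complex_inner_quantum_state_at:
  "complex_inner (quantum_state_at K s i x) (quantum_state_at K s j x) =
    complex_of_real (\<Sum>k\<in>UNIV. \<Sum>y\<in>UNIV. sqrt (trans_elem K s i k y x * trans_elem K s j k y x))"
proof -
  have "complex_inner (quantum_state_at K s i x) (quantum_state_at K s j x) =
      (\<Sum>(y, k)\<in>UNIV \<times> UNIV. complex_of_real (sqrt (trans_elem K s i k y x * trans_elem K s j k y x)))"
    by (simp add: complex_inner_def quantum_state_at_nth real_sqrt_mult split_def
        flip: UNIV_Times_UNIV)
       (auto intro!: sum.cong simp: quantum_state_at_nth)
  also have "\<dots> = (\<Sum>k\<in>UNIV. \<Sum>y\<in>UNIV.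
      complex_of_real (sqrt (trans_elem K s i k y x * trans_elem K s j k y x)))"
    by (subst sum.swap) (simp only: sum.cartesian_product)
  finally show ?thesis by simp
qed

lemma complex_inner_quantum_state_self:
  assumes "enumerates_causal_states K s"
  shows "complex_inner (quantum_state K s i) (quantum_state K s i) = 1"
  using sum_trans_elem[OF assms]
  by (simp add: quantum_state_def complex_inner_tensor_vec complex_inner_quantum_state_at
      trans_elem_nonneg)

text \<open>No cancellation is possible: each input contributes a sum of nonnegative terms, one of
  them nonzero, and a finite product of nonzero factors is nonzero.\<close>

lemma complex_inner_quantum_state_nonzero:
  assumes "\<And>x. \<exists>y k. trans_elem K s i k y x \<noteq> 0 \<and> trans_elem K s j k y x \<noteq> 0"
  shows "complex_inner (quantum_state K s i) (quantum_state K s j) \<noteq> 0"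
proof -
  have "(\<Sum>k\<in>UNIV. \<Sum>y\<in>UNIV. sqrt (trans_elem K s i k y x * trans_elem K s j k y x)) \<noteq> 0" for x
    using assms[of x] by (auto simp: sum_nonneg_eq_0_iff sum_nonneg trans_elem_nonneg)
  then show ?thesis
    by (simp add: quantum_state_def complex_inner_tensor_vec complex_inner_quantum_state_at
        del: of_real_sum)
qed

theorem mainTheorem2:
  fixes L :: "(int \<Rightarrow> 'x::finite) \<Rightarrow> (int \<Rightarrow> 'y::finite) measure"
    and K :: "('x, 'y) past \<Rightarrow> 'x \<Rightarrow> 'y pmf"
    and s :: "'k::finite \<Rightarrow> ('x, 'y) past set"
  assumes "io_process L K"
    and "enumerates_causal_states K s"
    and "step_wise_inefficient K s"
  shows "\<forall>\<mu>. stationary_input \<mu> \<and> non_pathological L K s \<mu> \<longrightarrow>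
    quantum_complexity L K s \<mu> < statistical_complexity L K s \<mu>"
proof (intro allI impI)
  fix \<mu> assume "stationary_input \<mu> \<and> non_pathological L K s \<mu>"
  then have "state_prob L K s \<mu> i > 0" for i
    by (simp add: non_pathological_def)
  \<comment> \<open>Distinct classes \<open>s a\<close> and \<open>s b\<close> come from distinct
    indices, as the mixture lemma asks.\<close>
  moreover obtain a b where "a \<noteq> b"
    and "\<And>x. \<exists>y k. trans_elem K s a k y x \<noteq> 0 \<and> trans_elem K s b k y x \<noteq> 0"
    using assms(3) unfolding step_wise_inefficient_def by metis
  ultimately show "quantum_complexity L K s \<mu> < statistical_complexity L K s \<mu>"
    unfolding quantum_complexity_def density_matrix_def statistical_complexity_def
    using assms(2)
    by (intro von_neumann_entropy_mixture_less[of _ _ a b] complex_inner_quantum_state_self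
        complex_inner_quantum_state_nonzero)
qed

end
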